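(* Let $(\mathbb X,\mathsf d)$ be a metric space with the Besicovitch property, let $\mu\in\mathscr F^*$, and write $b(q)=b_{\mu,\mathrm S_\mu}(q)$ for $q\in\mathbb R$. Let $J_b$ be the interior of the set where $b$ is finite. Suppose that for some $q\in J_b$ one has $\mathscr H_\mu^{q,b(q)}(\mathrm S_\mu)>0$, and let $$E=\Bigl\{x\in\mathrm S_\mu\ ;\ \liminf_{r\searrow0}\frac{\log\mu(\mathsf B(x,r))}{\log r}\le -b_l^\flat(q)\ \text{ and }\ \limsup_{r\searrow0}\frac{\log\mu(\mathsf B(x,r))}{\log r}\ge -b_r^\flat(q)\Bigr\}.$$ Then $$\dim_P E\ge\begin{cases} b(q)-q\,b_r^\flat(q)&\text{if }q\ge0,\\ b(q)-q\,b_l^\flat(q)&\text{if }q\le0.\end{cases}$$ In particular, if $b'(q)$ exists, then $$\dim_P\Bigl\{x\in\mathrm S_\mu\ ;\ \liminf_{r\searrow0}\frac{\log\mu(\mathsf B(x,r))}{\log r}\le -b'(q)\le\limsup_{r\searrow0}\frac{\log\mu(\mathsf B(x,r))}{\log r}\Bigr\}\ge b(q)-q\,b'(q).$$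
   Context: Besicovitch property: there is an integer constant $C_B$ such that from any collection $\mathcal B$ of balls one can extract $C_B$ countable families $\{\mathsf B_{j,k}\}_k$, $1\le j\le C_B$, such that $\bigcup_{j,k}\mathsf B_{j,k}$ contains the centers of all elements of $\mathcal B$ and, for each $j$, the balls $\mathsf B_{j,k}$ ($k$ varying) are pairwise disjoint. $\mathsf B(x,r)$ is the open ball; in a collection of balls $\{\mathsf B_j\}$, $\mathsf B_j=\mathsf B(x_j,r_j)$. $\mathscr B$ is the set of balls of $\mathbb X$, $\mathscr F$ the set of maps $\mathscr B\to[0,+\infty)$, and $\mathscr F^*$ the set of $\mu\in\mathscr F$ such that $\mu(\mathsf B)=0$ implies $\mu(\mathsf B')=0$ for all balls $\mathsf B'\subset\mathsf B$. For $\mu\in\mathscr F^*$, $\mathrm S_\mu$ is the complement of $\bigcup\{\mathsf B\in\mathscr B;\ \mu(\mathsf B)=0\}$. $\dim_P$ is the (Tricot) packing dimension. A centered $\delta$-cover of $E$ is a collection of balls with centers in $E$ and radii $\le\delta$ whose union contains $E$. For $q,t\in\mathbb R$, $\delta>0$, $E\subset\mathbb X$, $$\overline{\mathscr H}^{q,t}_{\mu,\delta}(E)=\inf\Bigl\{\sum\nolimits^{*} r_j^t\mu(\mathsf B_j)^q;\ \{\mathsf B_j\}\ \text{centered }\delta\text{-cover of }E\Bigr\},$$ where $*$ means summing only the terms with $\mu(\mathsf B_j)\ne0$; $\overline{\mathscr H}^{q,t}_{\mu}(E)=\lim_{\delta\searrow0}\overline{\mathscr H}^{q,t}_{\mu,\delta}(E)$;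 $\mathscr H^{q,t}_\mu(E)=\sup\{\overline{\mathscr H}^{q,t}_\mu(F);\ F\subset E\}$; and $b_{\mu,E}(q)=\inf\{t\in\mathbb R;\ \mathscr H^{q,t}_\mu(E)=0\}$. For a real function $\psi$: $\psi_l^\flat(q)=\limsup_{t\searrow0}\frac{\psi(q-t)-\psi(q)}{-t}$ and $\psi_r^\flat(q)=\limsup_{t\searrow0}\frac{\psi(q+t)-\psi(q)}{t}$. *)

theory Defs
  imports "HOL-Analysis.Analysis"
begin

text \<open>
  In a general metric space a ball, as a set, determines neither its center nor its radius.
  A collection of balls is therefore a set of pairs \<open>(x, r)\<close> with \<open>r > 0\<close>, standing for
  the balls \<open>ball x r\<close>; set functions such as \<open>\<mu>\<close> are evaluated at the balls as sets.
\<close>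

abbreviation the_ball :: "'a::metric_space \<times> real \<Rightarrow> 'a set" where
  "the_ball p \<equiv> ball (fst p) (snd p)"

definition ball_collection :: "('a::metric_space \<times> real) set \<Rightarrow> bool" where
  "ball_collection \<B> \<longleftrightarrow> (\<forall>p\<in>\<B>. 0 < snd p)"

definition besicovitch_property :: "'a::metric_space itself \<Rightarrow> bool" where
  "besicovitch_property _ \<longleftrightarrow>
     (\<exists>C::nat. \<forall>\<B> :: ('a \<times> real) set. ball_collection \<B> \<longrightarrow>
        (\<exists>\<F> :: nat \<Rightarrow> ('a \<times> real) set.
           (\<forall>j\<in>{1..C}. \<F> j \<subseteq> \<B> \<and> countable (\<F> j) \<and> disjoint_family_on the_ball (\<F> j)) \<and>
           fst ` \<B> \<subseteq> (\<Union>j\<in>{1..C}. \<Union>p\<in>\<F> j. the_ball p)))"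

definition all_balls :: "'a::metric_space set set" where
  "all_balls = {ball x r | x r. 0 < r}"

definition ball_functions :: "('a::metric_space set \<Rightarrow> real) set" where
  "ball_functions = all_balls \<rightarrow> {0..}"

definition ball_functions_star :: "('a::metric_space set \<Rightarrow> real) set" where
  "ball_functions_star =
     {\<mu> \<in> ball_functions. \<forall>B\<in>all_balls. \<mu> B = 0 \<longrightarrow> (\<forall>B'\<in>all_balls. B' \<subseteq> B \<longrightarrow> \<mu> B' = 0)}"

definition ball_support :: "('a::metric_space set \<Rightarrow> real) \<Rightarrow> 'a set" where
  "ball_support \<mu> = - \<Union>{B \<in> all_balls. \<mu> B = 0}"

definition centered_cover :: "real \<Rightarrow> 'a::metric_space set \<Rightarrow> ('a \<times> real) set \<Rightarrow> bool" where
  "centered_cover \<delta> E \<B> \<longleftrightarrow>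
     ball_collection \<B> \<and> (\<forall>p\<in>\<B>. fst p \<in> E \<and> snd p \<le> \<delta>) \<and> E \<subseteq> (\<Union>p\<in>\<B>. the_ball p)"

definition H_pre_\<delta> ::
  "('a::metric_space set \<Rightarrow> real) \<Rightarrow> real \<Rightarrow> real \<Rightarrow> real \<Rightarrow> 'a set \<Rightarrow> ennreal" where
  "H_pre_\<delta> \<mu> q t \<delta> E =
     (INF \<B>\<in>{\<B>. centered_cover \<delta> E \<B>}.
        \<Sum>\<^sub>\<infinity>p\<in>{p\<in>\<B>. \<mu> (the_ball p) \<noteq> 0}. ennreal (snd p powr t * \<mu> (the_ball p) powr q))"

definition H_pre ::
  "('a::metric_space set \<Rightarrow> real) \<Rightarrow> real \<Rightarrow> real \<Rightarrow> 'a set \<Rightarrow> ennreal" where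
  "H_pre \<mu> q t E = Lim (at_right 0) (\<lambda>\<delta>. H_pre_\<delta> \<mu> q t \<delta> E)"

definition H_meas ::
  "('a::metric_space set \<Rightarrow> real) \<Rightarrow> real \<Rightarrow> real \<Rightarrow> 'a set \<Rightarrow> ennreal" where
  "H_meas \<mu> q t E = (SUP F\<in>{F. F \<subseteq> E}. H_pre \<mu> q t F)"

definition b_fun :: "('a::metric_space set \<Rightarrow> real) \<Rightarrow> 'a set \<Rightarrow> real \<Rightarrow> ereal" where
  "b_fun \<mu> E q = Inf {ereal t | t. H_meas \<mu> q t E = 0}"

definition flat_left :: "(real \<Rightarrow> real) \<Rightarrow> real \<Rightarrow> ereal" where
  "flat_left \<psi> q = Limsup (at_right 0) (\<lambda>t. ereal ((\<psi> (q - t) - \<psi> q) / (- t)))"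

definition flat_right :: "(real \<Rightarrow> real) \<Rightarrow> real \<Rightarrow> ereal" where
  "flat_right \<psi> q = Limsup (at_right 0) (\<lambda>t. ereal ((\<psi> (q + t) - \<psi> q) / t))"

definition lower_local_dim :: "('a::metric_space set \<Rightarrow> real) \<Rightarrow> 'a \<Rightarrow> ereal" where
  "lower_local_dim \<mu> x = Liminf (at_right 0) (\<lambda>r. ereal (ln (\<mu> (ball x r)) / ln r))"

definition upper_local_dim :: "('a::metric_space set \<Rightarrow> real) \<Rightarrow> 'a \<Rightarrow> ereal" where
  "upper_local_dim \<mu> x = Limsup (at_right 0) (\<lambda>r. ereal (ln (\<mu> (ball x r)) / ln r))"

definition centered_packing :: "real \<Rightarrow> 'a::metric_space set \<Rightarrow> ('a \<times> real) set \<Rightarrow> bool" where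
  "centered_packing \<delta> E \<B> \<longleftrightarrow>
     ball_collection \<B> \<and> (\<forall>p\<in>\<B>. fst p \<in> E \<and> snd p \<le> \<delta>) \<and> disjoint_family_on the_ball \<B>"

definition packing_pre_\<delta> :: "real \<Rightarrow> real \<Rightarrow> 'a::metric_space set \<Rightarrow> ennreal" where
  "packing_pre_\<delta> t \<delta> E =
     (SUP \<B>\<in>{\<B>. centered_packing \<delta> E \<B>}. \<Sum>\<^sub>\<infinity>p\<in>\<B>. ennreal (snd p powr t))"

definition packing_pre :: "real \<Rightarrow> 'a::metric_space set \<Rightarrow> ennreal" where
  "packing_pre t E = Lim (at_right 0) (\<lambda>\<delta>. packing_pre_\<delta> t \<delta> E)"

definition packing_meas :: "real \<Rightarrow> 'a::metric_space set \<Rightarrow> ennreal" where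
  "packing_meas t E = (INF A\<in>{A :: nat \<Rightarrow> 'a set. E \<subseteq> (\<Union>i. A i)}. \<Sum>i. packing_pre t (A i))"

definition packing_dim :: "'a::metric_space set \<Rightarrow> ereal" where
  "packing_dim E = Inf {ereal t | t. 0 \<le> t \<and> packing_meas t E = 0}"

text \<open>
  Both limits as \<open>\<delta>\<close> decreases to \<open>0\<close> exist by monotonicity, so that \<open>Lim\<close> is meaningful.
\<close>

lemma tendsto_at_right_0_SUP:
  fixes f :: "real \<Rightarrow> ennreal"
  assumes anti: "\<And>x y. 0 < x \<Longrightarrow> x \<le> y \<Longrightarrow> f y \<le> f x"
  shows "(f \<longlongrightarrow> (SUP x\<in>{0<..}. f x)) (at_right 0)"
proof (rule order_tendstoI)
  fix a assume "a < (SUP x\<in>{0<..}. f x)"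
  then obtain y where y: "0 < y" "a < f y" by (auto simp: less_SUP_iff)
  have "\<forall>\<^sub>F x in at_right 0. x \<in> {0<..<y}" using y(1) by (rule eventually_at_right_real)
  then show "\<forall>\<^sub>F x in at_right 0. a < f x"
    by eventually_elim (use y anti[of _ y] in \<open>auto intro: less_le_trans\<close>)
next
  fix a assume a: "(SUP x\<in>{0<..}. f x) < a"
  have "\<forall>\<^sub>F x in at_right 0. x \<in> {0<..<(1::real)}" by (rule eventually_at_right_real) simp
  then show "\<forall>\<^sub>F x in at_right 0. f x < a"
    by eventually_elim (use a in \<open>auto intro: le_less_trans[OF SUP_upper]\<close>)
qed

lemma tendsto_at_right_0_INF:
  fixes f :: "real \<Rightarrow> ennreal"
  assumes mono: "\<And>x y. 0 < x \<Longrightarrow> x \<le> y \<Longrightarrow> f x \<le> f y"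
  shows "(f \<longlongrightarrow> (INF x\<in>{0<..}. f x)) (at_right 0)"
proof (rule order_tendstoI)
  fix a assume "(INF x\<in>{0<..}. f x) < a"
  then obtain y where y: "0 < y" "f y < a" by (auto simp: INF_less_iff)
  have "\<forall>\<^sub>F x in at_right 0. x \<in> {0<..<y}" using y(1) by (rule eventually_at_right_real)
  then show "\<forall>\<^sub>F x in at_right 0. f x < a"
    by eventually_elim (use y mono[of _ y] in \<open>auto intro: le_less_trans[of _ "f y"]\<close>)
next
  fix a assume a: "a < (INF x\<in>{0<..}. f x)"
  have "\<forall>\<^sub>F x in at_right 0. x \<in> {0<..<(1::real)}" by (rule eventually_at_right_real) simp
  then show "\<forall>\<^sub>F x in at_right 0. a < f x"
    by eventually_elim (use a in \<open>auto intro: less_le_trans[OF _ INF_lower]\<close>)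
qed

lemma H_pre_tendsto:
  "((\<lambda>\<delta>. H_pre_\<delta> \<mu> q t \<delta> E) \<longlongrightarrow> H_pre \<mu> q t E) (at_right 0)"
proof -
  have "((\<lambda>\<delta>. H_pre_\<delta> \<mu> q t \<delta> E) \<longlongrightarrow> (SUP \<delta>\<in>{0<..}. H_pre_\<delta> \<mu> q t \<delta> E)) (at_right 0)"
    by (rule tendsto_at_right_0_SUP, unfold H_pre_\<delta>_def, rule INF_superset_mono[OF _ order_refl])
       (unfold centered_cover_def, blast intro: order_trans)
  then show ?thesis unfolding H_pre_def by (simp add: tendsto_Lim)
qed

lemma packing_pre_tendsto:
  "((\<lambda>\<delta>. packing_pre_\<delta> t \<delta> E) \<longlongrightarrow> packing_pre t E) (at_right 0)"
proof -
  have "((\<lambda>\<delta>. packing_pre_\<delta> t \<delta> E) \<longlongrightarrow> (INF \<delta>\<in>{0<..}. packing_pre_\<delta> t \<delta> E)) (at_right 0)"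
    by (rule tendsto_at_right_0_INF, unfold packing_pre_\<delta>_def, rule SUP_subset_mono[OF _ order_refl])
       (unfold centered_packing_def, blast intro: order_trans)
  then show ?thesis unfolding packing_pre_def by (simp add: tendsto_Lim)
qed

end

theory Submission
  imports Defs
begin

text \<open>
  On the set where \<open>\<mu> (ball x r) \<le> r powr \<alpha>\<close> for all small \<open>r\<close>, the measure \<open>H_meas \<mu> q t\<close> is
  dominated by \<open>H_meas \<mu> (q - h) (t + \<alpha> * h)\<close> for every \<open>h > 0\<close>. If \<open>\<alpha> > - flat_left b q\<close>, some
  small \<open>h\<close> has \<open>b (q - h) < b q + \<alpha> * h\<close>, so the dominating measure vanishes for \<open>t = b q\<close>.
  The same argument with \<open>q + h\<close> handles the upper local dimension, and therefore \<open>E\<close> has positive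
  \<open>H_meas \<mu> q (b q)\<close>.

  If \<open>s < b q - q * flat_right b q\<close> with \<open>q > 0\<close> (and similarly for \<open>q \<le> 0\<close>), each point of \<open>E\<close>
  is the center of arbitrarily small balls with \<open>r powr b q * \<mu> (ball x r) powr q \<le> r powr s\<close>. The
  Besicovitch property extracts from these balls a cover consisting of boundedly many packings,
  which bounds \<open>H_meas \<mu> q (b q) E\<close> by a multiple of \<open>packing_meas s E\<close>. Hence
  \<open>packing_meas s E > 0\<close>.
\<close>

section \<open>Preliminaries on unordered sums, one-sided limits and logarithms\<close>

lemma summable_on_into_ennreal [simp]: "f summable_on A" for f :: "'a \<Rightarrow> ennreal"
  by (rule nonneg_summable_on_complete) simp

text \<open>The families \<open>B i\<close> may overlap. On a finite set of points, each point is
  counted by at least one indicator, and finite sums determine the unordered sum.\<close>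

lemma infsum_UN_le_suminf:
  fixes f :: "'a \<Rightarrow> ennreal" and B :: "nat \<Rightarrow> 'a set"
  shows "infsum f (\<Union>i. B i) \<le> (\<Sum>i. infsum f (B i))"
proof (rule infsum_le_finite_sums)
  fix F assume F: "finite F" "F \<subseteq> (\<Union>i. B i)"
  have "sum f F \<le> (\<Sum>x\<in>F. \<Sum>i. f x * indicator (B i) x)"
  proof (rule sum_mono)
    fix x assume "x \<in> F"
    then obtain i where "x \<in> B i" using F by auto
    then have "f x = (\<Sum>i\<in>{i}. f x * indicator (B i) x)" by simp
    also have "\<dots> \<le> (\<Sum>i. f x * indicator (B i) x)" by (rule sum_le_suminf) auto
    finally show "f x \<le> (\<Sum>i. f x * indicator (B i) x)" .
  qed
  also have "\<dots> = (\<Sum>i. \<Sum>x\<in>F. f x * indicator (B i) x)" by (rule suminf_sum[symmetric]) simp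
  also have "\<dots> \<le> (\<Sum>i. infsum f (B i))"
  proof (rule suminf_le)
    fix i
    have "(\<Sum>x\<in>F. f x * indicator (B i) x) = sum f (F \<inter> B i)"
      using F(1) by (simp add: indicator_def sum.inter_restrict if_distrib cong: if_cong)
    also have "\<dots> = infsum f (F \<inter> B i)" using F(1) by simp
    also have "\<dots> \<le> infsum f (B i)" by (rule infsum_mono_neutral) auto
    finally show "(\<Sum>x\<in>F. f x * indicator (B i) x) \<le> infsum f (B i)" .
  qed auto
  finally show "sum f F \<le> (\<Sum>i. infsum f (B i))" .
qed simp

lemma less_Limsup_imp_frequently:
  fixes f :: "_ \<Rightarrow> 'a :: complete_linorder"
  assumes "y < Limsup F f"
  shows "\<exists>\<^sub>F x in F. y < f x"
proof (rule ccontr)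
  assume "\<not> (\<exists>\<^sub>F x in F. y < f x)"
  then have "\<forall>\<^sub>F x in F. f x \<le> y" by (simp add: not_frequently not_less)
  then show False using Limsup_bounded assms by (metis leD)
qed

lemma Liminf_less_imp_frequently:
  fixes f :: "_ \<Rightarrow> 'a :: complete_linorder"
  assumes "Liminf F f < y"
  shows "\<exists>\<^sub>F x in F. f x < y"
proof (rule ccontr)
  assume "\<not> (\<exists>\<^sub>F x in F. f x < y)"
  then have "\<forall>\<^sub>F x in F. y \<le> f x" by (simp add: not_frequently not_less)
  then show False using Liminf_bounded assms by (metis leD)
qed

text \<open>Taking logarithms makes every comparison of weights below a linear inequality in
  \<open>ln r\<close> and \<open>ln m\<close>.\<close>

lemma powr_mult_le_powr_mult_iff:
  fixes r m :: real
  assumes "0 < r" "0 < m"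
  shows "r powr t * m powr q \<le> r powr t' * m powr q' \<longleftrightarrow>
         t * ln r + q * ln m \<le> t' * ln r + q' * ln m"
  using assms by (simp add: powr_def mult_exp_exp)

section \<open>Countable subadditivity of the multifractal measures\<close>

lemma H_pre_eq_SUP: "H_pre \<mu> q t E = (SUP \<delta>\<in>{0<..}. H_pre_\<delta> \<mu> q t \<delta> E)"
proof (rule tendsto_unique[OF _ H_pre_tendsto])
  show "((\<lambda>\<delta>. H_pre_\<delta> \<mu> q t \<delta> E) \<longlongrightarrow> (SUP \<delta>\<in>{0<..}. H_pre_\<delta> \<mu> q t \<delta> E)) (at_right 0)"
    by (rule tendsto_at_right_0_SUP, unfold H_pre_\<delta>_def, rule INF_superset_mono[OF _ order_refl])
       (unfold centered_cover_def, blast intro: order_trans)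
qed simp

text \<open>Nearly optimal covers of the pieces are united; their centers stay in the union, so the
  result is again a centered cover.\<close>

lemma H_pre_\<delta>_UN_le:
  fixes F :: "nat \<Rightarrow> 'a::metric_space set"
  shows "H_pre_\<delta> \<mu> q t \<delta> (\<Union>i. F i) \<le> (\<Sum>i. H_pre_\<delta> \<mu> q t \<delta> (F i))"
proof (cases "\<exists>i. H_pre_\<delta> \<mu> q t \<delta> (F i) = \<infinity>")
  case True
  then obtain i where i: "H_pre_\<delta> \<mu> q t \<delta> (F i) = \<infinity>" by auto
  have "(\<Sum>i\<in>{i}. H_pre_\<delta> \<mu> q t \<delta> (F i)) \<le> (\<Sum>i. H_pre_\<delta> \<mu> q t \<delta> (F i))"
    by (rule sum_le_suminf) auto
  with i have "(\<Sum>i. H_pre_\<delta> \<mu> q t \<delta> (F i)) = \<infinity>" by (simp add: top_unique)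
  then show ?thesis by simp
next
  case False
  define g where "g p = ennreal (snd p powr t * \<mu> (the_ball p) powr q)" for p
  define N where "N \<B> = {p\<in>\<B>. \<mu> (the_ball p) \<noteq> 0}" for \<B> :: "('a \<times> real) set"
  have H: "H_pre_\<delta> \<mu> q t \<delta> E = (INF \<B>\<in>{\<B>. centered_cover \<delta> E \<B>}. infsum g (N \<B>))" for E
    unfolding H_pre_\<delta>_def g_def N_def ..
  show ?thesis
  proof (rule ennreal_le_epsilon)
    fix e :: real assume e: "0 < e"
    have "\<exists>\<B>. centered_cover \<delta> (F i) \<B> \<and>
            infsum g (N \<B>) \<le> H_pre_\<delta> \<mu> q t \<delta> (F i) + ennreal (e * (1/2)^Suc i)" for i
    proof -
      \<comment> \<open>Strictness requires a finite value, which is why an infinite piece is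
        treated separately.\<close>
      have "H_pre_\<delta> \<mu> q t \<delta> (F i) < H_pre_\<delta> \<mu> q t \<delta> (F i) + ennreal (e * (1/2)^Suc i)"
        using False e by (auto simp: ennreal_add_left_cancel_less[where b=0, simplified] top.not_eq_extremum)
      then show ?thesis unfolding H[of "F i"] INF_less_iff by (auto intro: less_imp_le)
    qed
    then obtain \<B> where \<B>: "\<And>i. centered_cover \<delta> (F i) (\<B> i)"
      "\<And>i. infsum g (N (\<B> i)) \<le> H_pre_\<delta> \<mu> q t \<delta> (F i) + ennreal (e * (1/2)^Suc i)" by metis
    have "centered_cover \<delta> (\<Union>i. F i) (\<Union>i. \<B> i)"
      unfolding centered_cover_def ball_collection_def
    proof (intro conjI ballI subsetI)
      fix p assume "p \<in> (\<Union>i. \<B> i)"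
      then obtain i where "p \<in> \<B> i" by auto
      then show "0 < snd p" "fst p \<in> (\<Union>i. F i)" "snd p \<le> \<delta>"
        using \<B>(1)[of i] unfolding centered_cover_def ball_collection_def by auto
    next
      fix x assume "x \<in> (\<Union>i. F i)"
      then obtain i where "x \<in> F i" by auto
      then have "x \<in> (\<Union>p\<in>\<B> i. the_ball p)" using \<B>(1)[of i] unfolding centered_cover_def by blast
      then show "x \<in> (\<Union>p\<in>\<Union>i. \<B> i. the_ball p)" by auto
    qed
    then have "H_pre_\<delta> \<mu> q t \<delta> (\<Union>i. F i) \<le> infsum g (N (\<Union>i. \<B> i))"
      unfolding H by (auto intro: INF_lower)
    also have "N (\<Union>i. \<B> i) = (\<Union>i. N (\<B> i))" by (auto simp: N_def)
    also have "infsum g \<dots> \<le> (\<Sum>i. infsum g (N (\<B> i)))" by (rule infsum_UN_le_suminf)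
    also have "\<dots> \<le> (\<Sum>i. H_pre_\<delta> \<mu> q t \<delta> (F i) + ennreal (e * (1/2)^Suc i))"
      by (intro suminf_le \<B>(2)) auto
    also have "\<dots> = (\<Sum>i. H_pre_\<delta> \<mu> q t \<delta> (F i)) + (\<Sum>i. ennreal (e * (1/2)^Suc i))"
      by (rule suminf_add[symmetric]) auto
    also have "(\<Sum>i. ennreal (e * (1/2)^Suc i)) = ennreal e"
      using e sums_mult[OF power_half_series, of e] by (intro suminf_ennreal_eq) auto
    finally show "H_pre_\<delta> \<mu> q t \<delta> (\<Union>i. F i) \<le> (\<Sum>i. H_pre_\<delta> \<mu> q t \<delta> (F i)) + ennreal e" .
  qed
qed

lemma H_pre_UN_le:
  "H_pre \<mu> q t (\<Union>i::nat. F i) \<le> (\<Sum>i. H_pre \<mu> q t (F i))"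
  unfolding H_pre_eq_SUP[of _ _ _ "\<Union>i. F i"]
proof (rule SUP_least)
  fix \<delta> :: real assume "\<delta> \<in> {0<..}"
  then have "(\<Sum>i. H_pre_\<delta> \<mu> q t \<delta> (F i)) \<le> (\<Sum>i. H_pre \<mu> q t (F i))"
    unfolding H_pre_eq_SUP by (intro suminf_le SUP_upper) auto
  then show "H_pre_\<delta> \<mu> q t \<delta> (\<Union>i. F i) \<le> (\<Sum>i. H_pre \<mu> q t (F i))"
    using H_pre_\<delta>_UN_le order_trans by blast
qed

text \<open>Centers are confined to the covered set, so inclusion does not compare the covers behind
  \<open>H_pre\<close> directly; the supremum over subsets restores monotonicity.\<close>

lemma H_meas_mono: "A \<subseteq> B \<Longrightarrow> H_meas \<mu> q t A \<le> H_meas \<mu> q t B"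
  unfolding H_meas_def by (rule SUP_subset_mono) auto

lemma H_pre_le_H_meas: "A \<subseteq> B \<Longrightarrow> H_pre \<mu> q t A \<le> H_meas \<mu> q t B"
  unfolding H_meas_def by (rule SUP_upper) simp

lemma H_meas_le_suminf:
  assumes "E \<subseteq> (\<Union>i::nat. A i)"
  shows "H_meas \<mu> q t E \<le> (\<Sum>i. H_meas \<mu> q t (A i))"
  unfolding H_meas_def[of _ _ _ E]
proof (rule SUP_least)
  fix F assume "F \<in> {F. F \<subseteq> E}"
  then have "F = (\<Union>i. F \<inter> A i)" using assms by auto
  then have "H_pre \<mu> q t F \<le> (\<Sum>i. H_pre \<mu> q t (F \<inter> A i))"
    using H_pre_UN_le[of \<mu> q t "\<lambda>i. F \<inter> A i"] by simp
  also have "\<dots> \<le> (\<Sum>i. H_meas \<mu> q t (A i))" by (intro suminf_le H_pre_le_H_meas) auto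
  finally show "H_pre \<mu> q t F \<le> (\<Sum>i. H_meas \<mu> q t (A i))" .
qed

text \<open>The index type is any countable type, so that decompositions indexed by rationals,
  naturals or booleans are all covered.\<close>

lemma H_meas_null_UN:
  fixes A :: "'i::countable \<Rightarrow> 'a::metric_space set"
  assumes "E \<subseteq> (\<Union>i. A i)" "\<And>i. H_meas \<mu> q t (A i) = 0"
  shows "H_meas \<mu> q t E = 0"
proof -
  have "E \<subseteq> (\<Union>n. A (from_nat n))" using assms(1) surj_from_nat by (metis image_image)
  from H_meas_le_suminf[OF this, of \<mu> q t] show ?thesis by (simp add: assms(2))
qed

lemma H_meas_null_Un:
  assumes "H_meas \<mu> q t A = 0" "H_meas \<mu> q t B = 0"
  shows "H_meas \<mu> q t (A \<union> B) = 0"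
  by (rule H_meas_null_UN[of _ "\<lambda>i::bool. if i then A else B"]) (auto simp: assms)

section \<open>Comparison of the measures through their weights\<close>

text \<open>For \<delta> below \<open>\<delta>\<^sub>0\<close>, any centered cover of a subset of
  \<open>E\<close> uses only balls to which the hypothesis applies, so the same cover serves both
  sides and the sums compare term by term.\<close>

lemma H_meas_le_of_uniform_weight_le:
  assumes "0 < \<delta>\<^sub>0"
    and le: "\<And>x r. x \<in> E \<Longrightarrow> 0 < r \<Longrightarrow> r \<le> \<delta>\<^sub>0 \<Longrightarrow>
      r powr t * \<mu> (ball x r) powr q \<le> r powr t' * \<mu> (ball x r) powr q'"
  shows "H_meas \<mu> q t E \<le> H_meas \<mu> q' t' E"
proof -
  have "H_pre \<mu> q t F \<le> H_pre \<mu> q' t' F" if "F \<subseteq> E" for F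
  proof (rule tendsto_le[OF _ H_pre_tendsto H_pre_tendsto])
    show "\<forall>\<^sub>F \<delta> in at_right 0. H_pre_\<delta> \<mu> q t \<delta> F \<le> H_pre_\<delta> \<mu> q' t' \<delta> F"
      using eventually_at_right_real[OF assms(1)]
    proof eventually_elim
      case (elim \<delta>)
      show ?case unfolding H_pre_\<delta>_def
      proof (rule INF_mono, rule bexI)
        fix \<B> assume "\<B> \<in> {\<B>. centered_cover \<delta> F \<B>}"
        then show "(\<Sum>\<^sub>\<infinity>p\<in>{p \<in> \<B>. \<mu> (the_ball p) \<noteq> 0}. ennreal (snd p powr t * \<mu> (the_ball p) powr q))
          \<le> (\<Sum>\<^sub>\<infinity>p\<in>{p \<in> \<B>. \<mu> (the_ball p) \<noteq> 0}. ennreal (snd p powr t' * \<mu> (the_ball p) powr q'))"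
          using elim that
          by (intro infsum_mono ennreal_leI le summable_on_into_ennreal)
             (fastforce simp: centered_cover_def ball_collection_def)+
      qed
    qed
  qed simp
  then show ?thesis unfolding H_meas_def by (auto intro!: SUP_mono)
qed

text \<open>The threshold radius depends on the point. Splitting \<open>E\<close> by thresholds
  \<open>1/(n+1)\<close> gives countably many pieces on which the comparison is uniform.\<close>

lemma H_meas_null_of_eventually_weight_le:
  assumes "H_meas \<mu> q' t' E = 0"
    and ev: "\<And>x. x \<in> E \<Longrightarrow> \<forall>\<^sub>F r in at_right 0.
      r powr t * \<mu> (ball x r) powr q \<le> r powr t' * \<mu> (ball x r) powr q'"
  shows "H_meas \<mu> q t E = 0"
proof (rule H_meas_null_UN)
  define A where "A n = {x\<in>E. \<forall>r. 0 < r \<longrightarrow> r \<le> inverse (real (Suc n)) \<longrightarrow>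
      r powr t * \<mu> (ball x r) powr q \<le> r powr t' * \<mu> (ball x r) powr q'}" for n
  show "E \<subseteq> (\<Union>n. A n)"
  proof
    fix x assume x: "x \<in> E"
    obtain d where d: "0 < d" "\<And>r. 0 < r \<Longrightarrow> r < d \<Longrightarrow>
        r powr t * \<mu> (ball x r) powr q \<le> r powr t' * \<mu> (ball x r) powr q'"
      using ev[OF x] unfolding eventually_at_right_field by auto
    obtain n where "inverse (real (Suc n)) < d" using reals_Archimedean[OF d(1)] by auto
    with d(2) x have "x \<in> A n" unfolding A_def by force
    then show "x \<in> (\<Union>n. A n)" by blast
  qed
  show "H_meas \<mu> q t (A n) = 0" for n
  proof -
    have "H_meas \<mu> q t (A n) \<le> H_meas \<mu> q' t' (A n)"
      by (rule H_meas_le_of_uniform_weight_le[of "inverse (real (Suc n))"]) (auto simp: A_def)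
    also have "\<dots> \<le> H_meas \<mu> q' t' E" by (rule H_meas_mono) (auto simp: A_def)
    finally show ?thesis using assms(1) by simp
  qed
qed

text \<open>The measure vanishes for some exponent \<open>s < t\<close>, and for radii at most 1 the
  weight decreases as the exponent grows.\<close>

lemma H_meas_eq_0_of_b_fun_less:
  assumes "b_fun \<mu> E q < ereal t"
  shows "H_meas \<mu> q t E = 0"
proof -
  obtain s where s: "H_meas \<mu> q s E = 0" "s < t"
    using assms unfolding b_fun_def Inf_less_iff by auto
  have "H_meas \<mu> q t E \<le> H_meas \<mu> q s E"
  proof (rule H_meas_le_of_uniform_weight_le[of 1])
    fix x r assume "0 < r" "r \<le> (1::real)"
    then show "r powr t * \<mu> (ball x r) powr q \<le> r powr s * \<mu> (ball x r) powr q"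
      using s(2) by (intro mult_right_mono powr_mono') auto
  qed simp
  with s show ?thesis by simp
qed

section \<open>The Besicovitch property and the bound by packing measures\<close>

lemma packing_pre_mono:
  assumes "A \<subseteq> B"
  shows "packing_pre t A \<le> packing_pre t B"
proof (rule tendsto_le[OF _ packing_pre_tendsto packing_pre_tendsto])
  have "packing_pre_\<delta> t \<delta> A \<le> packing_pre_\<delta> t \<delta> B" for \<delta>
    unfolding packing_pre_\<delta>_def using assms
    by (intro SUP_subset_mono) (unfold centered_packing_def, blast+)
  then show "\<forall>\<^sub>F \<delta> in at_right 0. packing_pre_\<delta> t \<delta> A \<le> packing_pre_\<delta> t \<delta> B" by simp
qed simp

lemma H_meas_empty: "H_meas \<mu> q t {} = 0"
proof -
  have "centered_cover \<delta> {} {}" for \<delta> :: real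
    by (simp add: centered_cover_def ball_collection_def)
  then have "H_pre_\<delta> \<mu> q t \<delta> {} \<le> 0" for \<delta>
    unfolding H_pre_\<delta>_def by (intro INF_lower2[of "{}"]) auto
  then show ?thesis by (simp add: H_meas_def H_pre_eq_SUP)
qed

text \<open>The \<open>C\<close> disjoint families extracted from the small balls satisfying the
  weight bound together form a centered cover of \<open>F\<close>, while each alone is a centered
  packing. The constant depends only on the space, which matters when the bound is summed over
  infinitely many pieces.\<close>

lemma besicovitch_H_pre_le_packing_pre:
  assumes "besicovitch_property TYPE('a::metric_space)"
  obtains C :: nat where "\<And>\<mu> q t s (F :: 'a set).
    (\<And>x. x \<in> F \<Longrightarrow> \<exists>\<^sub>F r in at_right 0. r powr t * \<mu> (ball x r) powr q \<le> r powr s) \<Longrightarrow>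
    H_pre \<mu> q t F \<le> of_nat C * packing_pre s F"
proof -
  obtain C :: nat where C: "\<And>\<B> :: ('a \<times> real) set. ball_collection \<B> \<Longrightarrow>
        \<exists>\<F> :: nat \<Rightarrow> ('a \<times> real) set.
           (\<forall>j\<in>{1..C}. \<F> j \<subseteq> \<B> \<and> countable (\<F> j) \<and> disjoint_family_on the_ball (\<F> j)) \<and>
           fst ` \<B> \<subseteq> (\<Union>j\<in>{1..C}. \<Union>p\<in>\<F> j. the_ball p)"
    using assms unfolding besicovitch_property_def by blast
  show thesis
  proof (rule that[of C], rule tendsto_le[OF _ ennreal_tendsto_cmult[OF _ packing_pre_tendsto] H_pre_tendsto])
    fix \<mu> and q t s :: real and F :: "'a set"
    assume freq: "\<And>x. x \<in> F \<Longrightarrow>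
      \<exists>\<^sub>F r in at_right 0. r powr t * \<mu> (ball x r) powr q \<le> r powr s"
    have "H_pre_\<delta> \<mu> q t \<delta> F \<le> of_nat C * packing_pre_\<delta> s \<delta> F" if "0 < \<delta>" for \<delta>
    proof -
      define \<B> where "\<B> = {p. fst p \<in> F \<and> 0 < snd p \<and> snd p \<le> \<delta> \<and>
        snd p powr t * \<mu> (the_ball p) powr q \<le> snd p powr s}"
      have "\<exists>p\<in>\<B>. fst p = x" if "x \<in> F" for x
      proof -
        from frequently_eventually_frequently[OF freq[OF that] eventually_at_right_real[OF \<open>0 < \<delta>\<close>]]
        obtain r where "r \<in> {0<..<\<delta>}" "r powr t * \<mu> (ball x r) powr q \<le> r powr s"
          by (auto dest: frequently_ex)
        then have "(x, r) \<in> \<B>" using that by (simp add: \<B>_def)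
        then show ?thesis by force
      qed
      then have centers: "F \<subseteq> fst ` \<B>" by force
      have "ball_collection \<B>" by (simp add: ball_collection_def \<B>_def)
      from C[OF this] obtain \<F> where \<F>:
        "\<forall>j\<in>{1..C}. \<F> j \<subseteq> \<B> \<and> countable (\<F> j) \<and> disjoint_family_on the_ball (\<F> j)"
        "fst ` \<B> \<subseteq> (\<Union>j\<in>{1..C}. \<Union>p\<in>\<F> j. the_ball p)" by (elim exE conjE)
      \<comment> \<open>Padding with empty families indexes the union by all naturals, as countable
        subadditivity of \<open>infsum\<close> requires.\<close>
      define \<G> where "\<G> j = (if j \<in> {1..C} then \<F> j else {})" for j
      have \<G>: "\<G> j \<subseteq> \<B>" "disjoint_family_on the_ball (\<G> j)" for j
        using bspec[OF \<F>(1), of j] unfolding \<G>_def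
        by (simp_all add: disjoint_family_on_def)
      define g where "g p = ennreal (snd p powr t * \<mu> (the_ball p) powr q)" for p
      have "centered_cover \<delta> F (\<Union>j. \<G> j)"
      proof -
        have "(\<Union>j\<in>{1..C}. \<Union>p\<in>\<F> j. the_ball p) \<subseteq> (\<Union>p\<in>\<Union>j. \<G> j. the_ball p)"
        proof
          fix x assume "x \<in> (\<Union>j\<in>{1..C}. \<Union>p\<in>\<F> j. the_ball p)"
          then obtain j p where "j \<in> {1..C}" "p \<in> \<F> j" "x \<in> the_ball p" by blast
          then have "p \<in> (\<Union>j. \<G> j)" "x \<in> the_ball p" unfolding \<G>_def by (auto intro!: exI[of _ j])
          then show "x \<in> (\<Union>p\<in>\<Union>j. \<G> j. the_ball p)" by blast
        qed
        with centers \<F>(2) have "F \<subseteq> (\<Union>p\<in>\<Union>j. \<G> j. the_ball p)" by (meson order_trans)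
        moreover have "fst p \<in> F \<and> snd p \<le> \<delta> \<and> 0 < snd p" if "p \<in> (\<Union>j. \<G> j)" for p
          using that \<G>(1) unfolding \<B>_def by blast
        ultimately show ?thesis unfolding centered_cover_def ball_collection_def by blast
      qed
      then have "H_pre_\<delta> \<mu> q t \<delta> F \<le> infsum g {p \<in> (\<Union>j. \<G> j). \<mu> (the_ball p) \<noteq> 0}"
        unfolding H_pre_\<delta>_def g_def by (intro INF_lower) simp
      \<comment> \<open>Restoring the balls of measure zero only adds nonnegative terms.\<close>
      also have "\<dots> \<le> infsum g (\<Union>j. \<G> j)" by (rule infsum_mono_neutral) auto
      also have "\<dots> \<le> (\<Sum>j. infsum g (\<G> j))" by (rule infsum_UN_le_suminf)
      also have "\<dots> = (\<Sum>j\<in>{1..C}. infsum g (\<G> j))"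
        by (rule suminf_finite) (auto simp: \<G>_def)
      also have "\<dots> \<le> (\<Sum>j\<in>{1..C}. packing_pre_\<delta> s \<delta> F)"
      proof (rule sum_mono)
        fix j
        have "centered_packing \<delta> F (\<G> j)"
          using \<G>[of j] unfolding centered_packing_def ball_collection_def \<B>_def by auto
        moreover have "infsum g (\<G> j) \<le> (\<Sum>\<^sub>\<infinity>p\<in>\<G> j. ennreal (snd p powr s))"
          using \<G>(1)[of j] unfolding g_def \<B>_def by (intro infsum_mono ennreal_leI) auto
        ultimately show "infsum g (\<G> j) \<le> packing_pre_\<delta> s \<delta> F"
          unfolding packing_pre_\<delta>_def by (intro SUP_upper2[of "\<G> j"]) auto
      qed
      also have "\<dots> = of_nat C * packing_pre_\<delta> s \<delta> F" by simp
      finally show ?thesis .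
    qed
    then show "\<forall>\<^sub>F \<delta> in at_right 0. H_pre_\<delta> \<mu> q t \<delta> F \<le> of_nat C * packing_pre_\<delta> s \<delta> F"
      by (auto simp: eventually_at_right_field intro: exI[of _ 1])
  qed (auto simp: of_nat_less_top)
qed

text \<open>A countable cover of \<open>E\<close> with small total packing premeasure is cut down to
  \<open>E\<close>. The weight bound is pointwise and thus passes to every subset of a piece, so the
  supremum in \<open>H_meas\<close> obeys the same estimate.\<close>

lemma H_meas_null_of_packing_meas_null:
  fixes E :: "'a::metric_space set"
  assumes "besicovitch_property TYPE('a)" "packing_meas s E = 0"
    and freq: "\<And>x. x \<in> E \<Longrightarrow>
      \<exists>\<^sub>F r in at_right 0. r powr t * \<mu> (ball x r) powr q \<le> r powr s"
  shows "H_meas \<mu> q t E = 0"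
proof -
  obtain C :: nat where C: "H_pre \<mu> q t F \<le> of_nat C * packing_pre s F" if "F \<subseteq> E" for F
  proof (rule besicovitch_H_pre_le_packing_pre[OF assms(1)])
    fix C :: nat
    assume "\<And>\<mu> q t s (F :: 'a set).
      (\<And>x. x \<in> F \<Longrightarrow> \<exists>\<^sub>F r in at_right 0. r powr t * \<mu> (ball x r) powr q \<le> r powr s) \<Longrightarrow>
      H_pre \<mu> q t F \<le> of_nat C * packing_pre s F"
    from this[OF freq] show thesis by (intro that[of C]) blast
  qed
  have "H_meas \<mu> q t E \<le> 0"
  proof (rule ennreal_le_epsilon)
    fix e :: real assume e: "0 < e"
    \<comment> \<open>Dividing by \<open>C + 1\<close> keeps the denominator positive even for
      \<open>C = 0\<close>.\<close>
    have "packing_meas s E < ennreal (e / (real C + 1))" using assms(2) e by simp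
    then obtain A :: "nat \<Rightarrow> 'a set" where A: "E \<subseteq> (\<Union>i. A i)"
      "(\<Sum>i. packing_pre s (A i)) < ennreal (e / (real C + 1))"
      unfolding packing_meas_def INF_less_iff by auto
    have "H_meas \<mu> q t E \<le> (\<Sum>i. H_meas \<mu> q t (E \<inter> A i))"
      using A(1) by (intro H_meas_le_suminf) auto
    also have "\<dots> \<le> (\<Sum>i. of_nat C * packing_pre s (A i))"
    proof (rule suminf_le)
      fix i
      show "H_meas \<mu> q t (E \<inter> A i) \<le> of_nat C * packing_pre s (A i)"
        unfolding H_meas_def
      proof (rule SUP_least)
        fix F assume F: "F \<in> {F. F \<subseteq> E \<inter> A i}"
        then have "H_pre \<mu> q t F \<le> of_nat C * packing_pre s F" by (intro C) auto
        also have "\<dots> \<le> of_nat C * packing_pre s (A i)"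
          using F by (intro mult_left_mono packing_pre_mono) auto
        finally show "H_pre \<mu> q t F \<le> of_nat C * packing_pre s (A i)" .
      qed
    qed auto
    also have "\<dots> = of_nat C * (\<Sum>i. packing_pre s (A i))" by simp
    also have "\<dots> \<le> of_nat C * ennreal (e / (real C + 1))"
      using A(2) by (intro mult_left_mono) auto
    also have "\<dots> = ennreal (real C * (e / (real C + 1)))"
      using e by (simp only: ennreal_of_nat_eq_real_of_nat) (rule ennreal_mult[symmetric], auto)
    also have "\<dots> \<le> ennreal e" using e by (intro ennreal_leI) (simp add: field_simps)
    finally show "H_meas \<mu> q t E \<le> 0 + ennreal e" by simp
  qed
  then show ?thesis by simp
qed

lemma packing_dim_ge:
  assumes "\<And>s. ereal s < c \<Longrightarrow> packing_meas s E \<noteq> 0"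
  shows "c \<le> packing_dim E"
  unfolding packing_dim_def
proof (rule Inf_greatest)
  fix z assume "z \<in> {ereal t | t. 0 \<le> t \<and> packing_meas t E = 0}"
  then obtain t where "z = ereal t" "packing_meas t E = 0" by auto
  with assms[of t] show "c \<le> z" using not_less by blast
qed

section \<open>Null sets of points with exceptional local dimensions\<close>

text \<open>A ball of measure zero around \<open>x\<close> would have been removed from the support.
  Positivity gives the logarithms in the local dimensions their intended meaning.\<close>

lemma pos_on_ball_support:
  assumes "\<mu> \<in> ball_functions_star" "x \<in> ball_support \<mu>" "0 < r"
  shows "0 < \<mu> (ball x r)"
proof -
  have B: "ball x r \<in> all_balls" using assms(3) by (auto simp: all_balls_def)
  then have "0 \<le> \<mu> (ball x r)"
    using assms(1) by (auto simp: ball_functions_star_def ball_functions_def)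
  moreover have "\<mu> (ball x r) \<noteq> 0"
    using assms(2,3) B unfolding ball_support_def by force
  ultimately show ?thesis by simp
qed

lemma eventually_at_right_0_finite:
  fixes b :: "real \<Rightarrow> ereal"
  assumes "q \<in> interior {s. \<bar>b s\<bar> \<noteq> \<infinity>}"
  shows "\<forall>\<^sub>F h in at_right 0. \<bar>b (q - h)\<bar> \<noteq> \<infinity> \<and> \<bar>b (q + h)\<bar> \<noteq> \<infinity>"
proof -
  have "\<forall>\<^sub>F h in at_right 0. q - h \<in> interior {s. \<bar>b s\<bar> \<noteq> \<infinity>}"
    by (rule topological_tendstoD[OF _ open_interior assms]) (auto intro!: tendsto_eq_intros)
  moreover have "\<forall>\<^sub>F h in at_right 0. q + h \<in> interior {s. \<bar>b s\<bar> \<noteq> \<infinity>}"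
    by (rule topological_tendstoD[OF _ open_interior assms]) (auto intro!: tendsto_eq_intros)
  ultimately show ?thesis
    by eventually_elim (auto dest!: subsetD[OF interior_subset])
qed

context
  fixes \<mu> :: "'a::metric_space set \<Rightarrow> real" and q :: real and b :: "real \<Rightarrow> ereal" and b\<^sub>R :: "real \<Rightarrow> real"
  assumes b_eq: "b = b_fun \<mu> (ball_support \<mu>)"
    and b\<^sub>R_eq: "b\<^sub>R = (\<lambda>s. real_of_ereal (b s))"
    and star: "\<mu> \<in> ball_functions_star"
    and q: "q \<in> interior {s. \<bar>b s\<bar> \<noteq> \<infinity>}"
begin

lemma b_eq_ereal: "\<bar>b s\<bar> \<noteq> \<infinity> \<Longrightarrow> b s = ereal (b\<^sub>R s)"
  by (simp add: b\<^sub>R_eq ereal_real')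

text \<open>A rational \<alpha> fits strictly between the two quantities, so countably many \<alpha>
  suffice. For each, \<open>\<mu> (ball x r) \<le> r powr \<alpha>\<close> at small radii lets a
  factor \<open>\<mu> (ball x r) powr h\<close> be traded for
  \<open>r powr (\<alpha> * h)\<close>.\<close>

lemma H_meas_null_large_lower_local_dim:
  "H_meas \<mu> q (b\<^sub>R q) {x \<in> ball_support \<mu>. - flat_left b\<^sub>R q < lower_local_dim \<mu> x} = 0"
proof (rule H_meas_null_UN)
  \<comment> \<open>The condition on \<open>c\<close> alone sits inside the set, so the index can
    run over all rationals; unsuitable ones give the empty set.\<close>
  define A where "A c = {x \<in> ball_support \<mu>. - flat_left b\<^sub>R q < real_of_rat c \<and>
      real_of_rat c < lower_local_dim \<mu> x}" for c
  show "{x \<in> ball_support \<mu>. - flat_left b\<^sub>R q < lower_local_dim \<mu> x} \<subseteq> (\<Union>c. A c)"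
    by (auto simp: A_def dest: ereal_dense3)
  fix c :: rat
  define \<alpha> :: real where "\<alpha> = real_of_rat c"
  show "H_meas \<mu> q (b\<^sub>R q) (A c) = 0"
  proof (cases "- flat_left b\<^sub>R q < \<alpha>")
    case False
    then have "A c = {}" by (auto simp: A_def \<alpha>_def)
    then show ?thesis by (simp add: H_meas_empty)
  next
    case True
    then have "ereal (- \<alpha>) < flat_left b\<^sub>R q" by (cases "flat_left b\<^sub>R q") auto
    then have "\<exists>\<^sub>F h in at_right 0. ereal (- \<alpha>) < ereal ((b\<^sub>R (q - h) - b\<^sub>R q) / (- h))"
      unfolding flat_left_def by (rule less_Limsup_imp_frequently)
    \<comment> \<open>A limsup only provides suitable \<open>h\<close> frequently; one
      \<open>h\<close> that also keeps \<open>b (q - h)\<close> finite is enough.\<close>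
    from frequently_eventually_frequently[OF this
        eventually_conj[OF eventually_at_right_0_finite[OF q] eventually_at_right_less]]
    obtain h where h: "0 < h" "\<bar>b (q - h)\<bar> \<noteq> \<infinity>" "- \<alpha> < (b\<^sub>R (q - h) - b\<^sub>R q) / (- h)"
      by (auto dest!: frequently_ex)
    then have "b\<^sub>R (q - h) < b\<^sub>R q + \<alpha> * h" by (simp add: field_simps)
    then have "H_meas \<mu> (q - h) (b\<^sub>R q + \<alpha> * h) (ball_support \<mu>) = 0"
      using b_eq_ereal[OF h(2)] by (intro H_meas_eq_0_of_b_fun_less) (simp add: b_eq)
    moreover have "A c \<subseteq> ball_support \<mu>" by (auto simp: A_def)
    ultimately have null: "H_meas \<mu> (q - h) (b\<^sub>R q + \<alpha> * h) (A c) = 0"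
      by (metis H_meas_mono le_zero_eq)
    show ?thesis
    proof (rule H_meas_null_of_eventually_weight_le[OF null])
      fix x assume x: "x \<in> A c"
      then have "ereal \<alpha> < lower_local_dim \<mu> x" by (simp add: A_def \<alpha>_def)
      then have "\<forall>\<^sub>F r in at_right 0. ereal \<alpha> < ereal (ln (\<mu> (ball x r)) / ln r)"
        unfolding lower_local_dim_def by (rule less_LiminfD)
      with eventually_at_right_real[of 0 1, OF zero_less_one]
      show "\<forall>\<^sub>F r in at_right 0. r powr b\<^sub>R q * \<mu> (ball x r) powr q
          \<le> r powr (b\<^sub>R q + \<alpha> * h) * \<mu> (ball x r) powr (q - h)"
      proof eventually_elim
        case (elim r)
        then have "0 < \<mu> (ball x r)" using x by (intro pos_on_ball_support[OF star]) (auto simp: A_def)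
        \<comment> \<open>Since \<open>ln r < 0\<close>, clearing the denominator reverses the
          inequality.\<close>
        moreover have "ln (\<mu> (ball x r)) < \<alpha> * ln r" using elim by (simp add: field_simps)
        then have "h * ln (\<mu> (ball x r)) \<le> h * (\<alpha> * ln r)" using h(1) by simp
        ultimately show ?case
          using elim by (subst powr_mult_le_powr_mult_iff) (auto simp: algebra_simps)
      qed
    qed
  qed
qed

text \<open>The mirror argument, with \<open>\<mu> (ball x r) \<ge> r powr \<alpha>\<close> at small
  radii and exponent \<open>q + h\<close>. Here the limsup of the slopes lies below
  \<open>- \<alpha>\<close>, so every small \<open>h\<close> works.\<close>

lemma H_meas_null_small_upper_local_dim:
  "H_meas \<mu> q (b\<^sub>R q) {x \<in> ball_support \<mu>. upper_local_dim \<mu> x < - flat_right b\<^sub>R q} = 0"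
proof (rule H_meas_null_UN)
  define A where "A c = {x \<in> ball_support \<mu>. upper_local_dim \<mu> x < real_of_rat c \<and>
      real_of_rat c < - flat_right b\<^sub>R q}" for c
  show "{x \<in> ball_support \<mu>. upper_local_dim \<mu> x < - flat_right b\<^sub>R q} \<subseteq> (\<Union>c. A c)"
    by (auto simp: A_def dest: ereal_dense3)
  fix c :: rat
  define \<alpha> :: real where "\<alpha> = real_of_rat c"
  show "H_meas \<mu> q (b\<^sub>R q) (A c) = 0"
  proof (cases "\<alpha> < - flat_right b\<^sub>R q")
    case False
    then have "A c = {}" by (auto simp: A_def \<alpha>_def)
    then show ?thesis by (simp add: H_meas_empty)
  next
    case True
    then have "flat_right b\<^sub>R q < ereal (- \<alpha>)" by (cases "flat_right b\<^sub>R q") auto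
    then have "\<forall>\<^sub>F h in at_right 0. ereal ((b\<^sub>R (q + h) - b\<^sub>R q) / h) < ereal (- \<alpha>)"
      unfolding flat_right_def by (rule Limsup_lessD)
    from eventually_conj[OF this
        eventually_conj[OF eventually_at_right_0_finite[OF q] eventually_at_right_less]]
    obtain h where h: "0 < h" "\<bar>b (q + h)\<bar> \<noteq> \<infinity>" "(b\<^sub>R (q + h) - b\<^sub>R q) / h < - \<alpha>"
      by (auto dest!: eventually_happens)
    then have "b\<^sub>R (q + h) < b\<^sub>R q - \<alpha> * h" by (simp add: field_simps)
    then have "H_meas \<mu> (q + h) (b\<^sub>R q - \<alpha> * h) (ball_support \<mu>) = 0"
      using b_eq_ereal[OF h(2)] by (intro H_meas_eq_0_of_b_fun_less) (simp add: b_eq)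
    moreover have "A c \<subseteq> ball_support \<mu>" by (auto simp: A_def)
    ultimately have null: "H_meas \<mu> (q + h) (b\<^sub>R q - \<alpha> * h) (A c) = 0"
      by (metis H_meas_mono le_zero_eq)
    show ?thesis
    proof (rule H_meas_null_of_eventually_weight_le[OF null])
      fix x assume x: "x \<in> A c"
      then have "upper_local_dim \<mu> x < ereal \<alpha>" by (simp add: A_def \<alpha>_def)
      then have "\<forall>\<^sub>F r in at_right 0. ereal (ln (\<mu> (ball x r)) / ln r) < ereal \<alpha>"
        unfolding upper_local_dim_def by (rule Limsup_lessD)
      with eventually_at_right_real[of 0 1, OF zero_less_one]
      show "\<forall>\<^sub>F r in at_right 0. r powr b\<^sub>R q * \<mu> (ball x r) powr q
          \<le> r powr (b\<^sub>R q - \<alpha> * h) * \<mu> (ball x r) powr (q + h)"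
      proof eventually_elim
        case (elim r)
        then have "0 < \<mu> (ball x r)" using x by (intro pos_on_ball_support[OF star]) (auto simp: A_def)
        moreover have "\<alpha> * ln r < ln (\<mu> (ball x r))" using elim by (simp add: field_simps)
        then have "h * (\<alpha> * ln r) \<le> h * ln (\<mu> (ball x r))" using h(1) by simp
        ultimately show ?case
          using elim by (subst powr_mult_le_powr_mult_iff) (auto simp: algebra_simps)
      qed
    qed
  qed
qed

text \<open>The support is covered by this set and the two exceptional null sets.\<close>

lemma H_meas_pos_typical:
  assumes "H_meas \<mu> q (b\<^sub>R q) (ball_support \<mu>) > 0"
  shows "H_meas \<mu> q (b\<^sub>R q) {x \<in> ball_support \<mu>. lower_local_dim \<mu> x \<le> - flat_left b\<^sub>R q \<and>
           upper_local_dim \<mu> x \<ge> - flat_right b\<^sub>R q} \<noteq> 0" (is "H_meas _ _ _ ?E \<noteq> 0")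
proof
  assume "H_meas \<mu> q (b\<^sub>R q) ?E = 0"
  from H_meas_null_Un[OF this
      H_meas_null_Un[OF H_meas_null_large_lower_local_dim H_meas_null_small_upper_local_dim]]
  have "H_meas \<mu> q (b\<^sub>R q) (ball_support \<mu>) \<le> 0"
    by (rule order_trans[OF H_meas_mono eq_refl, rotated]) auto
  with assms show False by simp
qed

section \<open>Small weights at typical points\<close>

text \<open>For \<open>q > 0\<close>, arbitrarily small balls with
  \<open>\<mu> (ball x r) < r powr \<alpha>\<close> have weight at most
  \<open>r powr (b\<^sub>R q + q * \<alpha>)\<close>.\<close>

lemma frequently_weight_le_right:
  assumes "0 < q" "ereal s < b q - ereal q * flat_right b\<^sub>R q"
    and "x \<in> ball_support \<mu>" "- flat_right b\<^sub>R q \<le> upper_local_dim \<mu> x"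
  shows "\<exists>\<^sub>F r in at_right 0. r powr b\<^sub>R q * \<mu> (ball x r) powr q \<le> r powr s"
proof -
  \<comment> \<open>This is the solution of \<open>b\<^sub>R q + q * \<alpha> = s\<close>.\<close>
  define \<alpha> where "\<alpha> = (s - b\<^sub>R q) / q"
  have "b q = ereal (b\<^sub>R q)" using subsetD[OF interior_subset q] by (intro b_eq_ereal) simp
  then have "ereal \<alpha> < - flat_right b\<^sub>R q"
    using assms(1,2) by (cases "flat_right b\<^sub>R q") (auto simp: \<alpha>_def field_simps)
  with assms(4) have "ereal \<alpha> < upper_local_dim \<mu> x" by simp
  then have "\<exists>\<^sub>F r in at_right 0. ereal \<alpha> < ereal (ln (\<mu> (ball x r)) / ln r)"
    unfolding upper_local_dim_def by (rule less_Limsup_imp_frequently)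
  from frequently_eventually_frequently[OF this eventually_at_right_real[of 0 1, OF zero_less_one]]
  show ?thesis
  proof (rule frequently_elim1)
    fix r assume r: "ereal \<alpha> < ereal (ln (\<mu> (ball x r)) / ln r) \<and> r \<in> {0<..<1}"
    then have "0 < \<mu> (ball x r)" using assms(3) by (intro pos_on_ball_support[OF star]) auto
    moreover have "ln (\<mu> (ball x r)) < \<alpha> * ln r" using r by (auto simp: field_simps)
    then have "q * ln (\<mu> (ball x r)) \<le> q * (\<alpha> * ln r)" using assms(1) by simp
    then have "q * ln (\<mu> (ball x r)) \<le> (s - b\<^sub>R q) * ln r" using assms(1) by (simp add: \<alpha>_def)
    \<comment> \<open>With second exponent 0 on the right, the positive measure contributes the
      factor 1.\<close>
    ultimately show "r powr b\<^sub>R q * \<mu> (ball x r) powr q \<le> r powr s"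
      using r powr_mult_le_powr_mult_iff[of r "\<mu> (ball x r)" "b\<^sub>R q" q s 0] by (simp add: algebra_simps)
  qed
qed

text \<open>For \<open>q < 0\<close> a large measure makes the weight small, so the lower local
  dimension supplies balls with \<open>\<mu> (ball x r) > r powr \<alpha>\<close>.\<close>

lemma frequently_weight_le_left:
  assumes "q < 0" "ereal s < b q - ereal q * flat_left b\<^sub>R q"
    and "x \<in> ball_support \<mu>" "lower_local_dim \<mu> x \<le> - flat_left b\<^sub>R q"
  shows "\<exists>\<^sub>F r in at_right 0. r powr b\<^sub>R q * \<mu> (ball x r) powr q \<le> r powr s"
proof -
  define \<alpha> where "\<alpha> = (s - b\<^sub>R q) / q"
  have "b q = ereal (b\<^sub>R q)" using subsetD[OF interior_subset q] by (intro b_eq_ereal) simp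
  then have "- flat_left b\<^sub>R q < ereal \<alpha>"
    using assms(1,2) by (cases "flat_left b\<^sub>R q") (auto simp: \<alpha>_def field_simps)
  with assms(4) have "lower_local_dim \<mu> x < ereal \<alpha>" by simp
  then have "\<exists>\<^sub>F r in at_right 0. ereal (ln (\<mu> (ball x r)) / ln r) < ereal \<alpha>"
    unfolding lower_local_dim_def by (rule Liminf_less_imp_frequently)
  from frequently_eventually_frequently[OF this eventually_at_right_real[of 0 1, OF zero_less_one]]
  show ?thesis
  proof (rule frequently_elim1)
    fix r assume r: "ereal (ln (\<mu> (ball x r)) / ln r) < ereal \<alpha> \<and> r \<in> {0<..<1}"
    then have "0 < \<mu> (ball x r)" using assms(3) by (intro pos_on_ball_support[OF star]) auto
    moreover have "\<alpha> * ln r < ln (\<mu> (ball x r))" using r by (auto simp: field_simps)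
    then have "q * ln (\<mu> (ball x r)) \<le> q * (\<alpha> * ln r)" using assms(1) by simp
    then have "q * ln (\<mu> (ball x r)) \<le> (s - b\<^sub>R q) * ln r" using assms(1) by (simp add: \<alpha>_def)
    ultimately show "r powr b\<^sub>R q * \<mu> (ball x r) powr q \<le> r powr s"
      using r powr_mult_le_powr_mult_iff[of r "\<mu> (ball x r)" "b\<^sub>R q" q s 0] by (simp add: algebra_simps)
  qed
qed

text \<open>The weight reduces to \<open>r powr b\<^sub>R q\<close>. Positivity of the measure is
  essential, as \<open>0 powr 0 = 0\<close>.\<close>

lemma frequently_weight_le_zero:
  assumes "q = 0" "ereal s < b q" "x \<in> ball_support \<mu>"
  shows "\<exists>\<^sub>F r in at_right 0. r powr b\<^sub>R q * \<mu> (ball x r) powr q \<le> r powr s"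
proof (rule eventually_frequently)
  have "b q = ereal (b\<^sub>R q)" using subsetD[OF interior_subset q] by (intro b_eq_ereal) simp
  with assms(2) have s: "s \<le> b\<^sub>R q" by simp
  show "\<forall>\<^sub>F r in at_right 0. r powr b\<^sub>R q * \<mu> (ball x r) powr q \<le> r powr s"
    using eventually_at_right_real[of 0 1, OF zero_less_one]
  proof eventually_elim
    case (elim r)
    then have "0 < \<mu> (ball x r)" using assms(3) by (intro pos_on_ball_support[OF star]) auto
    then show ?case using assms(1) elim s by (auto intro!: powr_mono')
  qed
qed simp

end

section \<open>The differentiable case and the conclusion\<close>

lemma flat_eq_derivative:
  assumes "(\<psi> has_real_derivative D) (at q)"
  shows "flat_left \<psi> q = ereal D" "flat_right \<psi> q = ereal D"
proof -
  have lim: "((\<lambda>y. (\<psi> y - \<psi> q) / (y - q)) \<longlongrightarrow> D) (at q)"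
    using assms by (simp add: has_field_derivative_iff)
  \<comment> \<open>Composing with \<open>q - h\<close> and \<open>q + h\<close> turns the two-sided
    limit into the one-sided quotients, whose limsup is then their limit.\<close>
  have "filterlim (\<lambda>h. q - h) (at q) (at_right 0)"
    by (auto simp: filterlim_at eventually_at_filter intro!: tendsto_eq_intros)
  from filterlim_compose[OF lim this] show "flat_left \<psi> q = ereal D"
    unfolding flat_left_def by (intro lim_imp_Limsup) simp_all
  have "filterlim (\<lambda>h. q + h) (at q) (at_right 0)"
    by (auto simp: filterlim_at eventually_at_filter intro!: tendsto_eq_intros)
  from filterlim_compose[OF lim this] show "flat_right \<psi> q = ereal D"
    unfolding flat_right_def by (intro lim_imp_Limsup) simp_all
qed

theorem proposition8:
  fixes \<mu> :: "'a::metric_space set \<Rightarrow> real"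
    and q :: real
  defines "b \<equiv> b_fun \<mu> (ball_support \<mu>)"
  defines "b\<^sub>R \<equiv> (\<lambda>s. real_of_ereal (b s))"
  defines "E \<equiv> {x \<in> ball_support \<mu>. lower_local_dim \<mu> x \<le> - flat_left b\<^sub>R q \<and>
                                    upper_local_dim \<mu> x \<ge> - flat_right b\<^sub>R q}"
  assumes "besicovitch_property TYPE('a)"
    and "\<mu> \<in> ball_functions_star"
    and "q \<in> interior {s. \<bar>b s\<bar> \<noteq> \<infinity>}"
    and "H_meas \<mu> q (b\<^sub>R q) (ball_support \<mu>) > 0"
  shows "(q \<ge> 0 \<longrightarrow> packing_dim E \<ge> b q - ereal q * flat_right b\<^sub>R q) \<and>
         (q \<le> 0 \<longrightarrow> packing_dim E \<ge> b q - ereal q * flat_left b\<^sub>R q) \<and>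
         (\<forall>b'::real. (b\<^sub>R has_real_derivative b') (at q) \<longrightarrow>
            packing_dim {x \<in> ball_support \<mu>. lower_local_dim \<mu> x \<le> ereal (- b') \<and>
                                              ereal (- b') \<le> upper_local_dim \<mu> x}
              \<ge> b q - ereal (q * b'))"
proof -
  note ctx = b_def[THEN meta_eq_to_obj_eq] b\<^sub>R_def[THEN meta_eq_to_obj_eq] assms(5,6)
  have pos: "H_meas \<mu> q (b\<^sub>R q) E \<noteq> 0"
    unfolding E_def by (rule H_meas_pos_typical[OF ctx assms(7)])
  \<comment> \<open>If the packing measure of \<open>E\<close> vanished for some \<open>s\<close>
    below \<open>c\<close>, the weight bound would make \<open>E\<close> null, contradicting
    \<open>pos\<close>.\<close>
  have dim: "packing_dim E \<ge> c"
    if "\<And>s x. ereal s < c \<Longrightarrow> x \<in> E \<Longrightarrow>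
          \<exists>\<^sub>F r in at_right 0. r powr b\<^sub>R q * \<mu> (ball x r) powr q \<le> r powr s" for c
    using H_meas_null_of_packing_meas_null[OF assms(4)] pos that by (intro packing_dim_ge) metis
  have right: "packing_dim E \<ge> b q - ereal q * flat_right b\<^sub>R q" if "q \<ge> 0"
  proof (rule dim)
    fix s x assume "ereal s < b q - ereal q * flat_right b\<^sub>R q" "x \<in> E"
    \<comment> \<open>For \<open>q = 0\<close> the product with the slope is 0 even when the slope
      is infinite, by the convention for \<open>ereal\<close>.\<close>
    then show "\<exists>\<^sub>F r in at_right 0. r powr b\<^sub>R q * \<mu> (ball x r) powr q \<le> r powr s"
      using that frequently_weight_le_zero[OF ctx] frequently_weight_le_right[OF ctx]
      by (cases "q = 0") (auto simp: E_def zero_ereal_def[symmetric])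
  qed
  have left: "packing_dim E \<ge> b q - ereal q * flat_left b\<^sub>R q" if "q \<le> 0"
  proof (rule dim)
    fix s x assume "ereal s < b q - ereal q * flat_left b\<^sub>R q" "x \<in> E"
    then show "\<exists>\<^sub>F r in at_right 0. r powr b\<^sub>R q * \<mu> (ball x r) powr q \<le> r powr s"
      using that frequently_weight_le_zero[OF ctx] frequently_weight_le_left[OF ctx]
      by (cases "q = 0") (auto simp: E_def zero_ereal_def[symmetric])
  qed
  have "packing_dim {x \<in> ball_support \<mu>. lower_local_dim \<mu> x \<le> ereal (- b') \<and>
          ereal (- b') \<le> upper_local_dim \<mu> x} \<ge> b q - ereal (q * b')"
    if D: "(b\<^sub>R has_real_derivative b') (at q)" for b'
    \<comment> \<open>Both slopes equal \<open>b'\<close>, so the set is \<open>E\<close> and the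
      bounds for the two signs of \<open>q\<close> coincide.\<close>
    using right left linear[of 0 q] by (auto simp: E_def flat_eq_derivative[OF D])
  with right left show ?thesis by blast
qed

end
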